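(* For the evacuation problem on the line with exactly one sender and one receiver ($n_s=n_r=1$), there exists an evacuation algorithm with competitive ratio $3+2\sqrt{2}$.
   Context: Evacuation problem on the line: $n\ge 2$ agents start at time $0$ at the origin of the real line. Each agent can move in either direction with any speed at most $1$, changing speed and direction instantaneously and arbitrarily often. A target (exit) is at an unknown point $x\in\mathbb{R}$ with $|x|>1$; an agent detects the target when it visits its location. Co-located agents can always exchange information (face-to-face communication). Each agent is either a sender (can transmit messages wirelessly to all other agents at any distance, but can receive messages only face-to-face) or a receiver (can receive wireless messages from any distance, but can transmit only face-to-face); there are $n_s$ senders and $n_r=n-n_s$ receivers. The types of all agents and the algorithm are known to all agents in advance. An evacuation algorithm $\mathcal{A}$ prescribes the movement of every agent, both the search trajectory (a continuous map $X:[0,\infty)\to\mathbb{R}$ with $X(0)=0$ and $|X(t')-X(t)|\le t'-t$ for $t'\ge t\ge 0$) followed until the agent finds or is informed of the target, and its subsequent actions. $E(\mathcal{A},x)$ is the evacuation time, i.e. the time at which the last agent reaches the target when it is at $x$, and the competitive ratio is $\mathrm{CR}(\mathcal{A})=\sup_{|x|>1}E(\mathcal{A},x)/|x|$. *)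

theory Defs
  imports "HOL-Library.Extended_Real"
begin

text \<open>
  The agents are the elements of a finite type; time is the half-line \<open>t \<ge> 0\<close> of the reals, and
  nothing is required of trajectories at negative times.
\<close>

datatype agent_kind = Sender | Receiver

definition trajectory :: "(real \<Rightarrow> real) \<Rightarrow> bool" where
  "trajectory X \<longleftrightarrow> continuous_on {0..} X \<and> X 0 = 0 \<and>
     (\<forall>t t'. 0 \<le> t \<longrightarrow> t \<le> t' \<longrightarrow> \<bar>X t' - X t\<bar> \<le> t' - t)"

text \<open>
  \<open>informed kind P x i t\<close>: if the target is at \<open>x\<close> and the agents move along \<open>P\<close>, then by
  time \<open>t\<close> agent \<open>i\<close> has found the target or has been told where it is. Agents
  pass on what they know whenever they can; this loses no generality, because an informed agent is
  free to ignore the information.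
\<close>

inductive informed ::
  "('a \<Rightarrow> agent_kind) \<Rightarrow> ('a \<Rightarrow> real \<Rightarrow> real) \<Rightarrow> real \<Rightarrow> 'a \<Rightarrow> real \<Rightarrow> bool"
  for kind :: "'a \<Rightarrow> agent_kind" and P :: "'a \<Rightarrow> real \<Rightarrow> real" and x :: real
where
  find: "0 \<le> t \<Longrightarrow> P i t = x \<Longrightarrow> informed kind P x i t"
| remember: "informed kind P x i s \<Longrightarrow> s \<le> t \<Longrightarrow> informed kind P x i t"
| face_to_face: "informed kind P x j t \<Longrightarrow> P i t = P j t \<Longrightarrow> informed kind P x i t"
| wireless: "informed kind P x j t \<Longrightarrow> kind j = Sender \<Longrightarrow> kind i = Receiver
    \<Longrightarrow> informed kind P x i t"

text \<open>
  \<open>search A i\<close> is the search trajectory of agent \<open>i\<close>, and \<open>motion A x i\<close> is its whole movement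
  when the target is at \<open>x\<close>. The latter must follow the former as long as the agent is not informed.
  After that it may depend on \<open>x\<close> arbitrarily: all agents know the algorithm, so an agent
  that knows \<open>x\<close> can work out the entire execution, including when and how everyone gets informed.
\<close>

record 'a algorithm =
  search :: "'a \<Rightarrow> real \<Rightarrow> real"
  motion :: "real \<Rightarrow> 'a \<Rightarrow> real \<Rightarrow> real"

definition evacuation_algorithm :: "('a::finite \<Rightarrow> agent_kind) \<Rightarrow> 'a algorithm \<Rightarrow> bool" where
  "evacuation_algorithm kind A \<longleftrightarrow>
     (\<forall>i. trajectory (search A i)) \<and>
     (\<forall>x i. \<bar>x\<bar> > 1 \<longrightarrow> trajectory (motion A x i) \<and>
        (\<forall>t\<ge>0. \<not> informed kind (motion A x) x i t \<longrightarrow> motion A x i t = search A i t))"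

text \<open>
  An agent that finds the target and leaves it to inform another one has to come back, so its arrival
  time is the time from which it is at the target for good (\<open>\<infinity>\<close> if there is none).
\<close>

definition arrival_time :: "(real \<Rightarrow> real) \<Rightarrow> real \<Rightarrow> ereal" where
  "arrival_time X x = (INF T\<in>{T. 0 \<le> T \<and> (\<forall>t\<ge>T. X t = x)}. ereal T)"

definition evacuation_time :: "'a::finite algorithm \<Rightarrow> real \<Rightarrow> ereal" where
  "evacuation_time A x = (SUP i. arrival_time (motion A x i) x)"

definition competitive_ratio :: "'a::finite algorithm \<Rightarrow> ereal" where
  "competitive_ratio A = (SUP x\<in>{x. \<bar>x\<bar> > 1}. evacuation_time A x / ereal \<bar>x\<bar>)"

end

theory Submission
  imports Defs "HOL-Analysis.Elementary_Metric_Spaces"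
begin

text \<open>
  The receiver searches one half-line at full speed and the sender searches the other one at
  speed \<open>v = sqrt 2 - 1\<close>. If the sender finds the target at \<open>x < 0\<close>, at time \<open>\<bar>x\<bar> / v\<close>, the receiver
  turns around at once and arrives at time \<open>(2 / v + 1) \<bar>x\<bar>\<close>. If the receiver finds it at \<open>x > 0\<close>, it
  catches the sender at time \<open>2 x / (1 - v)\<close>, and both return to \<open>x\<close>, arriving
  at time \<open>(3 + v) / (1 - v) x\<close>. The speed \<open>v\<close> makes both factors equal to \<open>3 + 2 * sqrt 2\<close>.
\<close>

definition asym_search :: "agent_kind \<Rightarrow> real \<Rightarrow> real" where
  "asym_search k t = (case k of Sender \<Rightarrow> (1 - sqrt 2) * t | Receiver \<Rightarrow> t)"

text \<open>
  Every phase of the movement is linear in \<open>t\<close>, so the phases are joined by \<open>min\<close> and \<open>max\<close>. For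
  \<open>x > 0\<close> the agents meet at time \<open>(2 + sqrt 2) * x\<close> at the point \<open>- sqrt 2 * x\<close>, and the term
  \<open>min x (t - 2 * (x + sqrt 2 * x))\<close> is the common way back.
\<close>

definition asym_motion :: "real \<Rightarrow> agent_kind \<Rightarrow> real \<Rightarrow> real" where
  "asym_motion x k t =
    (if x > 0 then
       max (case k of Sender \<Rightarrow> (1 - sqrt 2) * t | Receiver \<Rightarrow> min t (2 * x - t))
         (min x (t - 2 * (x + sqrt 2 * x)))
     else
       max (case k of Sender \<Rightarrow> (1 - sqrt 2) * t | Receiver \<Rightarrow> min t (- 2 * (x + sqrt 2 * x) - t))
         x)"

definition asym_algorithm :: "('a \<Rightarrow> agent_kind) \<Rightarrow> 'a algorithm" where
  "asym_algorithm kind =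
    \<lparr>search = (\<lambda>i. asym_search (kind i)), motion = (\<lambda>x i. asym_motion x (kind i))\<rparr>"

text \<open>The speed bound makes \<open>X\<close> 1-Lipschitz on \<open>{0..}\<close>, so
  continuity comes for free.\<close>

lemma trajectoryI:
  assumes "X 0 = 0" and "\<And>t t'. 0 \<le> t \<Longrightarrow> t \<le> t' \<Longrightarrow> \<bar>X t' - X t\<bar> \<le> t' - t"
  shows "trajectory X"
proof -
  have "dist (X t') (X t) \<le> dist t' t" if "t \<ge> 0" "t' \<ge> 0" for t t'
    using assms(2)[of t t'] assms(2)[of t' t] that by (cases "t \<le> t'") (auto simp: dist_real_def)
  then have "continuous_on {0..} X"
    unfolding continuous_on_iff by (metis atLeast_iff le_less_trans)
  with assms show ?thesis
    by (auto simp: trajectory_def)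
qed

text \<open>Carries the speed bound through \<open>max\<close>; with its \<open>min\<close> twin it
  covers every joining of phases in \<open>asym_motion\<close>.\<close>

lemma abs_diff_max_le:
  fixes a b :: "'a::linordered_idom"
  assumes "\<bar>a - a'\<bar> \<le> d" "\<bar>b - b'\<bar> \<le> d"
  shows "\<bar>max a b - max a' b'\<bar> \<le> d"
  using assms by linarith

lemma abs_diff_min_le:
  fixes a b :: "'a::linordered_idom"
  assumes "\<bar>a - a'\<bar> \<le> d" "\<bar>b - b'\<bar> \<le> d"
  shows "\<bar>min a b - min a' b'\<bar> \<le> d"
  using assms by linarith

lemma sqrt2_bounds: "1 < sqrt (2::real)" "sqrt (2::real) < 2"
  by (auto intro: real_less_lsqrt)

lemma sender_speed:
  fixes t t' :: real
  assumes "t \<le> t'"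
  shows "(1 - sqrt 2) * t' \<le> (1 - sqrt 2) * t" "(1 - sqrt 2) * t - (1 - sqrt 2) * t' \<le> t' - t"
proof -
  show "(1 - sqrt 2) * t' \<le> (1 - sqrt 2) * t"
    using assms sqrt2_bounds by (intro mult_left_mono_neg) auto
  have "(sqrt 2 - 1) * (t' - t) \<le> 1 * (t' - t)"
    using assms sqrt2_bounds by (intro mult_right_mono) auto
  then show "(1 - sqrt 2) * t - (1 - sqrt 2) * t' \<le> t' - t"
    by (simp add: algebra_simps)
qed

lemma trajectory_asym_search: "trajectory (asym_search k)"
proof (rule trajectoryI)
  fix t t' :: real assume "t \<le> t'"
  from sender_speed[OF this] this show "\<bar>asym_search k t' - asym_search k t\<bar> \<le> t' - t"
    by (cases k) (auto simp: asym_search_def)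
qed (cases k; simp add: asym_search_def)

lemma trajectory_asym_motion: "trajectory (asym_motion x k)"
proof (rule trajectoryI)
  \<comment> \<open>Abstracting \<open>sqrt 2 * x\<close> leaves a problem linear in
    \<open>x\<close> and \<open>y\<close>, in which only the sign of \<open>y\<close>
    matters.\<close>
  define y where "y = sqrt 2 * x"
  have "y > 0 \<longleftrightarrow> x > 0"
    by (simp add: y_def zero_less_mult_iff)
  then show "asym_motion x k 0 = 0"
    by (cases k) (auto simp: asym_motion_def max_def min_def simp flip: y_def)
next
  fix t t' :: real assume "t \<le> t'"
  from sender_speed[OF this] this show "\<bar>asym_motion x k t' - asym_motion x k t\<bar> \<le> t' - t"
    unfolding asym_motion_def by (cases k) (auto intro!: abs_diff_max_le abs_diff_min_le)
qed

lemma asym_motion_before_target_found: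
  assumes "x > 0" "0 \<le> t" "t \<le> x"
  shows "asym_motion x Receiver t = t"
proof -
  define y where "y = sqrt 2 * x"
  have "y > 0"
    using assms by (simp add: y_def)
  with assms show ?thesis
    by (auto simp: asym_motion_def max_def min_def simp flip: y_def)
qed

text \<open>The way back crosses the sender's search line when
  \<open>sqrt 2 * t = 2 * (1 + sqrt 2) * x\<close>, that is, at the meeting time; before that
  \<open>max\<close> selects the search line.\<close>

lemma asym_motion_before_meeting:
  assumes "x > 0" "0 \<le> t" "t \<le> (2 + sqrt 2) * x"
  shows "asym_motion x Sender t = (1 - sqrt 2) * t"
proof -
  have "sqrt 2 * t \<le> sqrt 2 * ((2 + sqrt 2) * x)"
    using assms by (intro mult_left_mono) auto
  then have "t - 2 * (x + sqrt 2 * x) \<le> (1 - sqrt 2) * t"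
    using assms(3) by (simp add: algebra_simps)
  with assms(1) show ?thesis
    by (simp add: asym_motion_def max_def min_def)
qed

text \<open>The sender's search line, the receiver's chase \<open>2 * x - t\<close> and the way back
  all pass through this one point.\<close>

lemma asym_motion_meet:
  assumes "x > 0"
  shows "asym_motion x k ((2 + sqrt 2) * x) = - sqrt 2 * x"
proof -
  define y where "y = sqrt 2 * x"
  have "y > 0"
    using assms by (simp add: y_def)
  moreover have "(1 - sqrt 2) * ((2 + sqrt 2) * x) = - y" "(2 + sqrt 2) * x = 2 * x + y"
    by (simp_all add: y_def algebra_simps)
  ultimately show ?thesis
    using assms by (cases k) (auto simp: asym_motion_def max_def min_def simp flip: y_def)
qed

lemma asym_motion_before_message:
  assumes "x < 0" "0 \<le> t" "t \<le> - (1 + sqrt 2) * x"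
  shows "asym_motion x k t = asym_search k t"
proof -
  \<comment> \<open>As \<open>(sqrt 2 - 1) * (sqrt 2 + 1) = 1\<close>, the sender reaches
    \<open>x\<close> at time \<open>(1 + sqrt 2) * \<bar>x\<bar>\<close>, which is also where the
    receiver's \<open>min\<close> switches.\<close>
  have "x = (1 - sqrt 2) * (- (1 + sqrt 2) * x)"
    by (simp add: algebra_simps)
  also have "\<dots> \<le> (1 - sqrt 2) * t"
    by (rule sender_speed(1)[OF assms(3)])
  finally show ?thesis
    using assms by (cases k) (auto simp: asym_motion_def asym_search_def max_def min_def algebra_simps)
qed

lemma asym_motion_at_message:
  assumes "x < 0"
  shows "asym_motion x Sender (- (1 + sqrt 2) * x) = x"
  using assms by (simp add: asym_motion_def algebra_simps)

lemma asym_motion_evacuated: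
  assumes "(3 + 2 * sqrt 2) * \<bar>x\<bar> \<le> t"
  shows "asym_motion x k t = x"
proof -
  define y where "y = sqrt 2 * x"
  have abs_y: "sqrt 2 * \<bar>x\<bar> = \<bar>y\<bar>" and sgn_y: "y > 0 \<longleftrightarrow> x > 0"
    by (simp_all add: y_def abs_mult zero_less_mult_iff)
  have t: "3 * \<bar>x\<bar> + 2 * \<bar>y\<bar> \<le> t"
    using assms by (simp add: distrib_right flip: abs_y)
  \<comment> \<open>By now the sender's search line lies below \<open>x\<close> for either sign of
    \<open>x\<close>, so it no longer affects the \<open>max\<close>.\<close>
  have "(1 - sqrt 2) * t \<le> (1 - sqrt 2) * ((3 + 2 * sqrt 2) * \<bar>x\<bar>)"
    by (rule sender_speed(1)[OF assms])
  also have "\<dots> = - \<bar>x\<bar> - \<bar>y\<bar>"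
    by (simp add: algebra_simps flip: abs_y)
  finally show ?thesis
    using t sgn_y
    by (cases k; cases "x > 0") (auto simp: asym_motion_def max_def min_def simp flip: y_def)
qed

lemma asym_motion_not_evacuated:
  assumes "x < 0" "0 \<le> t" "t < (3 + 2 * sqrt 2) * \<bar>x\<bar>"
  shows "asym_motion x Receiver t \<noteq> x"
  using assms by (auto simp: asym_motion_def max_def min_def algebra_simps)

lemma evacuation_algorithm_asym:
  fixes kind :: "'a::finite \<Rightarrow> agent_kind"
  assumes "kind a = Sender" and "kind b = Receiver"
  shows "evacuation_algorithm kind (asym_algorithm kind)"
proof -
  have "asym_motion x (kind i) t = asym_search (kind i) t"
    if x: "\<bar>x\<bar> > 1" and t: "t \<ge> 0" and uninf: "\<not> informed kind (\<lambda>i. asym_motion x (kind i)) x i t"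
    for x i t
  proof (cases "x > 0")
    case True
    have receiver: "informed kind (\<lambda>i. asym_motion x (kind i)) x j s"
      if "kind j = Receiver" "x \<le> s" for j s
      using that True asym_motion_before_target_found[of x x]
      by (intro informed.remember[OF informed.find[of x]]) auto
    show ?thesis
    proof (cases "kind i")
      case Receiver
      then have "t \<le> x"
        using receiver[of i t] uninf by linarith
      with True t show ?thesis
        by (simp add: Receiver asym_motion_before_target_found asym_search_def)
    next
      case Sender
      let ?T = "(2 + sqrt 2) * x"
      have "x \<le> ?T"
        using True by (simp add: algebra_simps)
      \<comment> \<open>At time \<open>?T\<close> the sender stands where receiver \<open>b\<close>
        does, and \<open>b\<close> has known the target since time \<open>x\<close>.\<close>
      then have "informed kind (\<lambda>i. asym_motion x (kind i)) x i ?T"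
        using receiver[OF assms(2)] True
        by (intro informed.face_to_face[of kind _ x b ?T i]) (auto simp only: asym_motion_meet)
      with uninf have "t \<le> ?T"
        by (meson informed.remember linear)
      with True t show ?thesis
        by (simp add: Sender asym_motion_before_meeting asym_search_def)
    qed
  next
    case False
    with x have neg: "x < 0"
      by auto
    let ?T = "- (1 + sqrt 2) * x"
    have "0 \<le> ?T"
      by (intro mult_nonpos_nonpos) (use neg sqrt2_bounds in linarith)+
    then have sender: "informed kind (\<lambda>i. asym_motion x (kind i)) x j ?T" if "kind j = Sender" for j
      using that asym_motion_at_message[OF neg] by (intro informed.find) auto
    \<comment> \<open>A receiver gets the message at the very instant of discovery.\<close>
    have "informed kind (\<lambda>i. asym_motion x (kind i)) x i ?T"
      using sender informed.wireless[OF sender[OF assms(1)] assms(1)] by (cases "kind i") auto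
    with uninf have "t \<le> ?T"
      by (meson informed.remember linear)
    with neg t show ?thesis
      by (rule asym_motion_before_message)
  qed
  then show ?thesis
    by (auto simp: evacuation_algorithm_def asym_algorithm_def trajectory_asym_search
        trajectory_asym_motion)
qed

lemma evacuation_time_asym_le:
  "evacuation_time (asym_algorithm kind) x \<le> ereal ((3 + 2 * sqrt 2) * \<bar>x\<bar>)"
  unfolding evacuation_time_def arrival_time_def
  by (intro SUP_least INF_lower) (auto simp: asym_algorithm_def asym_motion_evacuated)

lemma evacuation_time_asym_ge:
  assumes "kind b = Receiver" and "x < 0"
  shows "ereal ((3 + 2 * sqrt 2) * \<bar>x\<bar>) \<le> evacuation_time (asym_algorithm kind) x"
proof -
  \<comment> \<open>An admissible \<open>T\<close> puts the receiver at \<open>x\<close> already at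
    time \<open>T\<close> itself.\<close>
  have "(3 + 2 * sqrt 2) * \<bar>x\<bar> \<le> T" if "0 \<le> T" "\<forall>t\<ge>T. asym_motion x Receiver t = x" for T
    using that asym_motion_not_evacuated[OF assms(2), of T] by force
  then have "ereal ((3 + 2 * sqrt 2) * \<bar>x\<bar>) \<le> arrival_time (motion (asym_algorithm kind) x b) x"
    unfolding arrival_time_def using assms(1) by (intro INF_greatest) (auto simp: asym_algorithm_def)
  also have "\<dots> \<le> evacuation_time (asym_algorithm kind) x"
    unfolding evacuation_time_def by (rule SUP_upper) simp
  finally show ?thesis .
qed

lemma competitive_ratio_asym:
  assumes "kind b = Receiver"
  shows "competitive_ratio (asym_algorithm kind) = ereal (3 + 2 * sqrt 2)"
  unfolding competitive_ratio_def
proof (rule antisym[OF SUP_least])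
  fix x :: real assume "x \<in> {x. \<bar>x\<bar> > 1}"
  then show "evacuation_time (asym_algorithm kind) x / ereal \<bar>x\<bar> \<le> ereal (3 + 2 * sqrt 2)"
    using evacuation_time_asym_le[of kind x]
    by (subst ereal_divide_le_pos) (auto simp: mult.commute)
next
  \<comment> \<open>Any target below \<open>-1\<close> attains the ratio; \<open>-2\<close> is an
    arbitrary choice.\<close>
  have "ereal (3 + 2 * sqrt 2) \<le> evacuation_time (asym_algorithm kind) (-2) / ereal \<bar>-2\<bar>"
    using evacuation_time_asym_ge[of kind b "-2"] assms
    by (subst ereal_le_divide_pos) (auto simp: mult.commute)
  also have "\<dots> \<le> (SUP x\<in>{x. \<bar>x\<bar> > 1}. evacuation_time (asym_algorithm kind) x / ereal \<bar>x\<bar>)"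
    by (rule SUP_upper) simp
  finally show "ereal (3 + 2 * sqrt 2) \<le> \<dots>" .
qed

theorem theorem1:
  fixes kind :: "'a::finite \<Rightarrow> agent_kind"
  assumes "card {i. kind i = Sender} = 1" and "card {i. kind i = Receiver} = 1"
  shows "\<exists>A. evacuation_algorithm kind A \<and> competitive_ratio A = ereal (3 + 2 * sqrt 2)"
proof -
  obtain a b where "kind a = Sender" "kind b = Receiver"
    using assms by (auto simp: card_1_singleton_iff)
  then show ?thesis
    using evacuation_algorithm_asym[of kind a b] competitive_ratio_asym[of kind b] by auto
qed

end
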